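(* There exist an absolute constant $C>0$ and an online matching algorithm such that, for every simple graph $G=(V,E)$ with known maximum degree $\Delta$ whose edges arrive online in an order fixed in advance by an oblivious adversary, the random matching $M$ output by the algorithm satisfies $$\Pr[e\in M]\ \ge\ \frac{1}{\Delta + C\,\Delta^{3/4}\log^{1/2}\Delta}\ =\ \frac{1}{(1+o(1))\Delta}\qquad\text{for every } e\in E.$$
   Context: Online matching under edge arrivals: the edges of $G$ are revealed one at a time; when an edge arrives, the algorithm must immediately and irrevocably decide whether to add it to its matching, and may add it only if neither endpoint is already matched. The algorithm may be randomized; the graph and arrival order are fixed before the algorithm's randomness is drawn (oblivious adversary). The paper writes the bound as $1/(\Delta+\Theta(\Delta^{3/4}\log^{1/2}\Delta))$. *)

theory Defs
  imports
    "HOL-Probability.Probability_Mass_Function"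
    "HOL-Library.Landau_Symbols"
begin

text \<open>
  Vertices are natural numbers, so that one constant and one algorithm serve all finite graphs;
  with a type variable, both could depend on the vertex type. An algorithm for this
  vertex type handles any other one by numbering the vertices as they first appear.
\<close>

type_synonym edge = "nat set"

definition simple_graph :: "nat set \<Rightarrow> edge set \<Rightarrow> bool" where
  "simple_graph V E \<longleftrightarrow> finite V \<and> (\<forall>e\<in>E. e \<subseteq> V \<and> card e = 2)"

definition degree :: "edge set \<Rightarrow> nat \<Rightarrow> nat" where
  "degree E v = card {e \<in> E. v \<in> e}"

text \<open>Unspecified for the graph without vertices, which has no edges.\<close>

definition max_degree :: "nat set \<Rightarrow> edge set \<Rightarrow> nat" where
  "max_degree V E = Max (degree E ` V)"

definition arrival_order :: "edge set \<Rightarrow> edge list \<Rightarrow> bool" where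
  "arrival_order E es \<longleftrightarrow> distinct es \<and> set es = E"

definition matching :: "edge set \<Rightarrow> edge set \<Rightarrow> bool" where
  "matching E M \<longleftrightarrow> M \<subseteq> E \<and> (\<forall>e\<in>M. \<forall>f\<in>M. e \<noteq> f \<longrightarrow> e \<inter> f = {})"

text \<open>
  A history lists the edges that have arrived, oldest first, each with the decision made on it
  (\<open>True\<close> if it was added to the matching).
\<close>

type_synonym history = "(edge \<times> bool) list"

definition accepted :: "history \<Rightarrow> edge set" where
  "accepted h = {e. (e, True) \<in> set h}"

text \<open>
  An algorithm maps the maximum degree, the history and the arriving edge to a distribution
  over decisions. It does not see the vertex set or the edges still to come. Fresh
  randomness at every step loses no generality: a random seed drawn at the start can be replaced by
  drawing each decision conditionally on the history.
\<close>

type_synonym online_alg = "nat \<Rightarrow> history \<Rightarrow> edge \<Rightarrow> bool pmf"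

text \<open>An edge may be added only if neither endpoint is already matched.\<close>

definition online_matching_alg :: "online_alg \<Rightarrow> bool" where
  "online_matching_alg A \<longleftrightarrow>
     (\<forall>\<Delta> h e. (\<exists>f\<in>accepted h. e \<inter> f \<noteq> {}) \<longrightarrow> True \<notin> set_pmf (A \<Delta> h e))"

primrec run :: "(history \<Rightarrow> edge \<Rightarrow> bool pmf) \<Rightarrow> history \<Rightarrow> edge list \<Rightarrow> history pmf" where
  "run D h [] = return_pmf h"
| "run D h (e # es) = bind_pmf (D h e) (\<lambda>b. run D (h @ [(e, b)]) es)"

text \<open>
  The adversary is oblivious: the list \<open>es\<close> is fixed before any randomness is drawn.
\<close>

definition random_matching :: "online_alg \<Rightarrow> nat \<Rightarrow> edge list \<Rightarrow> edge set pmf" where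
  "random_matching A \<Delta> es = map_pmf accepted (run (A \<Delta>) [] es)"

lemma run_matching:
  assumes "online_matching_alg A" "h' \<in> set_pmf (run (A \<Delta>) h es)"
    and "matching E (accepted h)" "set es \<subseteq> E"
  shows "matching E (accepted h')"
  using assms(2-4)
proof (induction es arbitrary: h)
  case Nil
  then show ?case by simp
next
  case (Cons e es)
  from Cons.prems(1) obtain b where b: "b \<in> set_pmf (A \<Delta> h e)"
    and h': "h' \<in> set_pmf (run (A \<Delta>) (h @ [(e, b)]) es)"
    by auto
  have acc: "accepted (h @ [(e, b)]) = (if b then insert e (accepted h) else accepted h)"
    by (auto simp: accepted_def)
  have dis: "e \<inter> f = {}" if "b" "f \<in> accepted h" for f
  proof (rule ccontr)
    assume "e \<inter> f \<noteq> {}"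
    then have "True \<notin> set_pmf (A \<Delta> h e)"
      using assms(1) that(2) unfolding online_matching_alg_def by blast
    then show False using b that(1) by simp
  qed
  have "matching E (accepted (h @ [(e, b)]))"
  proof (cases b)
    case True
    have "e \<in> E" using Cons.prems(3) by simp
    with Cons.prems(2) dis[OF True] show ?thesis
      unfolding acc matching_def using True by (simp add: Int_commute)
  next
    case False
    then show ?thesis using Cons.prems(2) acc by simp
  qed
  then show ?case using Cons.IH h' Cons.prems(3) by simp
qed

lemma random_matching_matching:
  assumes "online_matching_alg A" "arrival_order E es"
    and "M \<in> set_pmf (random_matching A \<Delta> es)"
  shows "matching E M"
proof -
  obtain h' where h': "h' \<in> set_pmf (run (A \<Delta>) [] es)" "M = accepted h'"
    using assms(3) unfolding random_matching_def set_map_pmf by blast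
  have "matching E (accepted [])" by (simp add: matching_def accepted_def)
  moreover have "set es \<subseteq> E" using assms(2) by (simp add: arrival_order_def)
  ultimately show ?thesis using run_matching[OF assms(1) h'(1)] h'(2) by simp
qed

end

theory Submission
  imports Defs "HOL-Real_Asymp.Real_Asymp"
begin

text \<open>
  Every vertex \<open>v\<close> carries \<open>F v\<close>, the product of \<open>1 - P f\<close> over the edges \<open>f\<close> at \<open>v\<close> so far, where
  \<open>P f\<close> is the probability with which \<open>f\<close> was accepted. A new edge \<open>{u, v}\<close> with free endpoints is
  accepted with probability \<open>p / (F u * F v)\<close>. Put \<open>Y v = 1 / F v\<close> while \<open>v\<close> is free and \<open>Y v = 0\<close>
  afterwards. Then \<open>Y u * Y v\<close> is a martingale until \<open>{u, v}\<close> arrives, so \<open>{u, v}\<close> enters the matching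
  with probability exactly \<open>p\<close>, up to one defect: the rule is suspended when it would push some \<open>F\<close>
  below \<open>\<theta>\<close>, which keeps the probabilities below \<open>1\<close>.

  While \<open>v\<close> is free, \<open>1 - F v\<close> is the sum of \<open>p * Y a\<close> over the neighbours \<open>a\<close> whose edge to \<open>v\<close> has
  been processed without suspension, each taken at the arrival of that edge. Adding \<open>p * Y a\<close> for the
  neighbours still to come gives a supermartingale that starts at most at \<open>p * \<Delta> < 1 - \<theta>\<close> and
  has to exceed \<open>1 - \<theta>\<close> for a suspension at \<open>v\<close>. Its quadratic variation is controlled
  by the increase of the sum of \<open>1 / (F a)^2\<close>, hence is at most \<open>p^2 * \<Delta> / \<theta>^2\<close>, and an exponential
  moment bound makes suspensions unlikely once \<open>\<theta>\<close> is of order \<open>\<Delta> powr (- 1 / 4) * sqrt (ln \<Delta>)\<close>.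
\<close>

section \<open>The algorithm and its state\<close>

text \<open>A state consists of the set of matched vertices and the function \<open>F\<close>.\<close>

type_synonym state = "nat set \<times> (nat \<Rightarrow> real)"

definition accept_prob :: "real \<Rightarrow> real \<Rightarrow> state \<Rightarrow> edge \<Rightarrow> real" where
  "accept_prob p \<theta> s e =
     (let P = p / (\<Prod>v\<in>e. snd s v)
      in if e \<inter> fst s = {} \<and> (\<forall>v\<in>e. \<theta> \<le> snd s v * (1 - P)) then P else 0)"

text \<open>Both outcomes of a decision rescale \<open>F\<close> in the same way and differ only in
  the matched set. The sums of \<open>1 / (F a)^2\<close> therefore grow by the same amount whether
  the edge is accepted or rejected, which the potential argument relies on.\<close>

definition update :: "real \<Rightarrow> real \<Rightarrow> state \<Rightarrow> edge \<Rightarrow> bool \<Rightarrow> state" where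
  "update p \<theta> s e b =
     (if b then fst s \<union> e else fst s,
      \<lambda>v. if v \<in> e then snd s v * (1 - accept_prob p \<theta> s e) else snd s v)"

definition state_of :: "real \<Rightarrow> real \<Rightarrow> history \<Rightarrow> state" where
  "state_of p \<theta> h = foldl (\<lambda>s (e, b). update p \<theta> s e b) ({}, \<lambda>_. 1) h"

definition natural_step :: "real \<Rightarrow> real \<Rightarrow> history \<Rightarrow> edge \<Rightarrow> bool pmf" where
  "natural_step p \<theta> h e = bernoulli_pmf (accept_prob p \<theta> (state_of p \<theta> h) e)"

text \<open>
  The expectation of \<open>f\<close> after \<open>es\<close> has been processed, as a plain recursion over the two outcomes:
  linearity and monotonicity then need no integrability.
\<close>

primrec expect :: "real \<Rightarrow> real \<Rightarrow> (state \<Rightarrow> real) \<Rightarrow> state \<Rightarrow> edge list \<Rightarrow> real" where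
  "expect p \<theta> f s [] = f s"
| "expect p \<theta> f s (e # es) =
     accept_prob p \<theta> s e * expect p \<theta> f (update p \<theta> s e True) es
     + (1 - accept_prob p \<theta> s e) * expect p \<theta> f (update p \<theta> s e False) es"

definition weight :: "state \<Rightarrow> nat \<Rightarrow> real" where
  "weight s v = (if v \<in> fst s then 0 else 1 / snd s v)"

definition valid :: "real \<Rightarrow> state \<Rightarrow> bool" where
  "valid \<theta> s \<longleftrightarrow> (\<forall>v. \<theta> \<le> snd s v \<and> snd s v \<le> 1)"

lemma state_of_Nil [simp]: "state_of p \<theta> [] = ({}, \<lambda>_. 1)"
  by (simp add: state_of_def)

lemma state_of_snoc [simp]: "state_of p \<theta> (h @ [(e, b)]) = update p \<theta> (state_of p \<theta> h) e b"
  by (simp add: state_of_def)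

lemma fst_state_of: "fst (state_of p \<theta> h) = \<Union> (accepted h)"
proof (induction h rule: rev_induct)
  case Nil
  then show ?case by (simp add: accepted_def)
next
  case (snoc x h)
  obtain e b where x: "x = (e, b)" by (cases x)
  have "accepted (h @ [x]) = (if b then insert e (accepted h) else accepted h)"
    by (auto simp: accepted_def x)
  with snoc show ?case by (auto simp: x update_def)
qed

lemma natural_step_respects_matching:
  assumes "\<exists>f\<in>accepted h. e \<inter> f \<noteq> {}"
  shows "True \<notin> set_pmf (natural_step p \<theta> h e)"
proof -
  have "e \<inter> fst (state_of p \<theta> h) \<noteq> {}"
    using assms by (auto simp: fst_state_of)
  then have "accept_prob p \<theta> (state_of p \<theta> h) e = 0"
    by (simp add: accept_prob_def)
  then show ?thesis by (simp add: natural_step_def set_pmf_iff)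
qed

lemma set_pmf_run:
  "h' \<in> set_pmf (run D h es) \<Longrightarrow> \<exists>t. h' = h @ t \<and> map fst t = es"
proof (induction es arbitrary: h)
  case Nil
  then show ?case by simp
next
  case (Cons e es)
  then obtain b where "h' \<in> set_pmf (run D (h @ [(e, b)]) es)" by auto
  from Cons.IH[OF this] show ?case by force
qed

lemma prob_bind_bernoulli:
  assumes "0 \<le> r" "r \<le> 1"
  shows "measure_pmf.prob (bernoulli_pmf r \<bind> f) X
    = r * measure_pmf.prob (f True) X + (1 - r) * measure_pmf.prob (f False) X"
proof -
  have "ennreal (measure_pmf.prob (bernoulli_pmf r \<bind> f) X)
      = (\<integral>\<^sup>+b. ennreal (measure_pmf.prob (f b) X) \<partial>bernoulli_pmf r)"
    by (simp flip: measure_pmf.emeasure_eq_measure)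
  also have "\<dots> = ennreal (r * measure_pmf.prob (f True) X + (1 - r) * measure_pmf.prob (f False) X)"
    using assms by (simp add: nn_integral_bernoulli_pmf ennreal_mult mult.commute)
  finally show ?thesis
    by (subst (asm) ennreal_inj) (use assms in auto)
qed

section \<open>Invariants of the state, and expectation as a recursion\<close>

context
  fixes p \<theta> :: real
  assumes p: "0 < p" and \<theta>: "0 < \<theta>"
begin

lemma validD: "valid \<theta> s \<Longrightarrow> \<theta> \<le> snd s v \<and> 0 < snd s v \<and> snd s v \<le> 1"
  using \<theta> by (fastforce simp: valid_def intro: less_le_trans)

text \<open>Strictness comes from the suspension test: a nonzero probability \<open>P\<close> has
  passed \<open>\<theta> \<le> F v * (1 - P)\<close> with \<open>\<theta>\<close> positive.\<close>

lemma accept_prob_bounds: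
  assumes "valid \<theta> s" "e \<noteq> {}"
  shows "0 \<le> accept_prob p \<theta> s e" "accept_prob p \<theta> s e < 1"
proof -
  have F: "0 < (\<Prod>v\<in>e. snd s v)" using validD[OF assms(1)] by (intro prod_pos) auto
  then show "0 \<le> accept_prob p \<theta> s e"
    using p by (auto simp: accept_prob_def Let_def)
  show "accept_prob p \<theta> s e < 1"
  proof (cases "accept_prob p \<theta> s e = 0")
    case False
    obtain v where "v \<in> e" using assms(2) by auto
    with False have "\<theta> \<le> snd s v * (1 - accept_prob p \<theta> s e)"
      by (auto simp: accept_prob_def Let_def split: if_splits)
    then have "0 < snd s v * (1 - accept_prob p \<theta> s e)" using \<theta> by linarith
    then show ?thesis using validD[OF assms(1), of v] by (simp add: zero_less_mult_iff)
  qed simp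
qed

lemma valid_update:
  assumes "valid \<theta> s" "e \<noteq> {}"
  shows "valid \<theta> (update p \<theta> s e b)"
proof -
  have "\<theta> \<le> snd s v * (1 - accept_prob p \<theta> s e)" if "v \<in> e" for v
    using validD[OF assms(1), of v] that by (auto simp: accept_prob_def Let_def)
  moreover have "snd s v * (1 - accept_prob p \<theta> s e) \<le> 1" for v
    using validD[OF assms(1), of v] accept_prob_bounds[OF assms] by (intro mult_le_one) auto
  ultimately show ?thesis
    using validD[OF assms(1)] by (auto simp: valid_def update_def)
qed

lemma expect_mono:
  assumes "valid \<theta> s" "{} \<notin> set es" "\<And>s. valid \<theta> s \<Longrightarrow> f s \<le> g s"
  shows "expect p \<theta> f s es \<le> expect p \<theta> g s es"
  using assms(1,2)
proof (induction es arbitrary: s)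
  case Nil
  then show ?case using assms(3) by simp
next
  case (Cons e es)
  have e: "e \<noteq> {}" "{} \<notin> set es" using Cons.prems by auto
  note b = accept_prob_bounds[OF Cons.prems(1) e(1)]
  show ?case
    using b Cons.IH[OF valid_update[OF Cons.prems(1) e(1)] e(2)]
    by (auto intro!: add_mono mult_left_mono)
qed

lemma expect_add: "expect p \<theta> (\<lambda>s. f s + g s) s es = expect p \<theta> f s es + expect p \<theta> g s es"
  by (induction es arbitrary: s) (simp_all add: algebra_simps)

lemma expect_cmult: "expect p \<theta> (\<lambda>s. c * f s) s es = c * expect p \<theta> f s es"
  by (induction es arbitrary: s) (simp_all add: algebra_simps)

lemma prob_run_Cons:
  assumes "valid \<theta> (state_of p \<theta> h)" "e \<noteq> {}"
  shows "measure_pmf.prob (run (natural_step p \<theta>) h (e # es)) X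
    = accept_prob p \<theta> (state_of p \<theta> h) e
        * measure_pmf.prob (run (natural_step p \<theta>) (h @ [(e, True)]) es) X
    + (1 - accept_prob p \<theta> (state_of p \<theta> h) e)
        * measure_pmf.prob (run (natural_step p \<theta>) (h @ [(e, False)]) es) X"
proof -
  have "run (natural_step p \<theta>) h (e # es) = bernoulli_pmf (accept_prob p \<theta> (state_of p \<theta> h) e)
      \<bind> (\<lambda>b. run (natural_step p \<theta>) (h @ [(e, b)]) es)"
    by (simp add: natural_step_def)
  then show ?thesis
    using accept_prob_bounds[OF assms] by (simp add: prob_bind_bernoulli)
qed

text \<open>The edge occurs only once, so its fate is settled on arrival: the prefix determines the
  state that it meets, and later decisions cannot change the outcome.\<close>

lemma prob_accepted_eq_expect:
  assumes "valid \<theta> (state_of p \<theta> h)" "{} \<notin> set (es @ e # es')" "distinct (es @ e # es')"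
    and "(e, True) \<notin> set h"
  shows "measure_pmf.prob (run (natural_step p \<theta>) h (es @ e # es')) {h. e \<in> accepted h}
    = expect p \<theta> (\<lambda>s. accept_prob p \<theta> s e) (state_of p \<theta> h) es"
  using assms
proof (induction es arbitrary: h)
  case Nil
  have e: "e \<noteq> {}" using Nil(2) by auto
  have "measure_pmf.prob (run (natural_step p \<theta>) (h @ [(e, True)]) es') {h. e \<in> accepted h} = 1"
    by (subst measure_pmf.prob_eq_1) (auto simp: AE_measure_pmf_iff accepted_def dest!: set_pmf_run)
  moreover have "(e, True) \<notin> set h'"
    if "h' \<in> set_pmf (run (natural_step p \<theta>) (h @ [(e, False)]) es')" for h'
    using set_pmf_run[OF that] Nil(3,4) by force
  then have "measure_pmf.prob (run (natural_step p \<theta>) (h @ [(e, False)]) es') {h. e \<in> accepted h} = 0"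
    by (subst measure_pmf.prob_eq_0) (auto simp: AE_measure_pmf_iff accepted_def)
  ultimately show ?case
    by (simp add: prob_run_Cons[OF Nil(1) e] del: run.simps)
next
  case (Cons f es)
  have f: "f \<noteq> {}" "f \<noteq> e" using Cons.prems by auto
  have IH: "measure_pmf.prob (run (natural_step p \<theta>) (h @ [(f, x)]) (es @ e # es')) {h. e \<in> accepted h}
    = expect p \<theta> (\<lambda>s. accept_prob p \<theta> s e) (update p \<theta> (state_of p \<theta> h) f x) es" for x
    using Cons.IH[of "h @ [(f, x)]"] valid_update[OF Cons.prems(1) f(1), of x] Cons.prems f by simp
  show ?case by (simp add: prob_run_Cons[OF Cons.prems(1) f(1)] IH del: run.simps)
qed

text \<open>\<open>\<Phi>\<close> also takes the edges to come, because \<open>gap\<close> sums over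
  future neighbours. What the step hypothesis may assume about \<open>rest\<close>, distinctness and
  inclusion in the whole list, is inherited along the induction.\<close>

lemma expect_supermartingale:
  assumes "valid \<theta> s" "{} \<notin> set es"
    and "distinct (es @ es')"
    and step: "\<And>s e rest. valid \<theta> s \<Longrightarrow> e \<in> set es \<Longrightarrow> distinct (e # rest) \<Longrightarrow>
      set (e # rest) \<subseteq> set (es @ es') \<Longrightarrow>
      accept_prob p \<theta> s e * \<Phi> rest (update p \<theta> s e True)
      + (1 - accept_prob p \<theta> s e) * \<Phi> rest (update p \<theta> s e False) \<le> \<Phi> (e # rest) s"
  shows "expect p \<theta> (\<Phi> es') s es \<le> \<Phi> (es @ es') s"
  using assms
proof (induction es arbitrary: s)
  case Nil
  then show ?case by simp
next
  case (Cons e es)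
  have e: "e \<noteq> {}" using Cons.prems by auto
  note b = accept_prob_bounds[OF Cons.prems(1) e]
  have IH: "expect p \<theta> (\<Phi> es') (update p \<theta> s e x) es \<le> \<Phi> (es @ es') (update p \<theta> s e x)" for x
    by (rule Cons.IH[OF valid_update[OF Cons.prems(1) e]])
       (use Cons.prems(2,3) in simp, use Cons.prems(3) in simp, rule Cons.prems(4), auto)
  have "expect p \<theta> (\<Phi> es') s (e # es)
      \<le> accept_prob p \<theta> s e * \<Phi> (es @ es') (update p \<theta> s e True)
      + (1 - accept_prob p \<theta> s e) * \<Phi> (es @ es') (update p \<theta> s e False)"
    using b IH by (auto intro!: add_mono mult_left_mono)
  also have "\<dots> \<le> \<Phi> (e # es @ es') s"
    using Cons.prems(1,3) by (intro Cons.prems(4)) auto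
  finally show ?case by simp
qed

section \<open>Weights and their product martingale\<close>

lemma weight_update_other: "a \<notin> e \<Longrightarrow> weight (update p \<theta> s e b) a = weight s a"
  by (simp add: weight_def update_def)

lemma weight_nonneg: "valid \<theta> s \<Longrightarrow> 0 \<le> weight s v"
  using validD[of s v] by (simp add: weight_def)

lemma weight_le: "valid \<theta> s \<Longrightarrow> weight s v \<le> 1 / \<theta>"
  using validD[of s v] \<theta> by (simp add: weight_def frac_le)

lemma weight_update_True: "a \<in> e \<Longrightarrow> weight (update p \<theta> s e True) a = 0"
  by (simp add: weight_def update_def)

lemma weight_update_False:
  "a \<in> e \<Longrightarrow> weight (update p \<theta> s e False) a = weight s a / (1 - accept_prob p \<theta> s e)"
  by (simp add: weight_def update_def)

lemma update_False_eq: "accept_prob p \<theta> s e = 0 \<Longrightarrow> update p \<theta> s e False = s"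
  by (intro prod_eqI ext) (auto simp: update_def)

text \<open>An edge with two endpoints other than \<open>{u, v}\<close> meets at most one of
  \<open>u\<close> and \<open>v\<close>. The weight there becomes \<open>0\<close> with probability
  \<open>P\<close> and is divided by \<open>1 - P\<close> otherwise, so its mean is kept while the
  other factor stays fixed.\<close>

lemma expect_weight_mult:
  assumes "valid \<theta> s" "u \<noteq> v" "{u, v} \<notin> set es" "\<forall>e\<in>set es. card e = 2"
  shows "expect p \<theta> (\<lambda>s. weight s u * weight s v) s es = weight s u * weight s v"
  using assms(1,3,4)
proof (induction es arbitrary: s)
  case Nil
  then show ?case by simp
next
  case (Cons e es)
  let ?P = "accept_prob p \<theta> s e"
  have e: "e \<noteq> {}" using Cons.prems(3) by auto
  note b = accept_prob_bounds[OF Cons.prems(1) e]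
  have IH: "expect p \<theta> (\<lambda>s. weight s u * weight s v) (update p \<theta> s e x) es
      = weight (update p \<theta> s e x) u * weight (update p \<theta> s e x) v" for x
    by (rule Cons.IH[OF valid_update[OF Cons.prems(1) e]]) (use Cons.prems in auto)
  have "\<not> (u \<in> e \<and> v \<in> e)"
  proof
    assume "u \<in> e \<and> v \<in> e"
    then have "{u, v} = e" using Cons.prems(3) assms(2)
      by (intro card_subset_eq) (auto intro: card_ge_0_finite)
    then show False using Cons.prems(2) by simp
  qed
  then consider "u \<in> e" "v \<notin> e" | "u \<notin> e" "v \<in> e" | "u \<notin> e" "v \<notin> e" by blast
  then show ?case
    using b by cases (simp_all add: IH weight_update_other weight_update_True weight_update_False field_simps)
qed

section \<open>Exponential supermartingale for the suspension criterion\<close>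

text \<open>The past neighbours enter through \<open>1 - F v\<close> rather than as a sum of their
  former weights, so the quantity depends only on the current state and the remaining edges.\<close>

definition gap :: "nat \<Rightarrow> edge list \<Rightarrow> state \<Rightarrow> real" where
  "gap v rest s = 1 - snd s v + p * (\<Sum>a | {v, a} \<in> set rest. weight s a)"

text \<open>
  The sum over the fixed set \<open>N\<close> pays for the variance. It includes neighbours whose edge to \<open>v\<close> has
  arrived, since dropping their terms would increase the potential.
\<close>

definition potential :: "real \<Rightarrow> nat \<Rightarrow> nat set \<Rightarrow> edge list \<Rightarrow> state \<Rightarrow> real" where
  "potential \<mu> v N rest s = exp (\<mu> * gap v rest s - (\<mu> * p)\<^sup>2 * (\<Sum>a\<in>N. 1 / (snd s a)\<^sup>2))"

text \<open>A Bernstein-type bound: the variable that is \<open>- c\<close> with probability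
  \<open>P\<close> and \<open>c * P / (1 - P)\<close> otherwise has mean zero and variance
  \<open>c^2 * P / (1 - P)\<close>. The condition on \<open>c\<close> keeps both values in
  \<open>[-1, 1]\<close>, where \<open>exp x\<close> is at most \<open>1 + x + x^2\<close>.\<close>

lemma exp_two_point_bound:
  fixes P c :: real
  assumes "0 \<le> P" "P < 1" "0 \<le> c" "c \<le> 1 - P"
  shows "P * exp (- c) + (1 - P) * exp (c * P / (1 - P)) \<le> exp (c\<^sup>2 * P / (1 - P))"
proof -
  have "c * P \<le> 1 * (1 - P)" using assms by (smt (verit) mult_left_le)
  then have d: "0 \<le> c * P / (1 - P)" "c * P / (1 - P) \<le> 1" using assms by auto
  \<comment> \<open>The product equals \<open>1 + c^3\<close>.\<close>
  have "1 \<le> (1 - c + c\<^sup>2) * (1 + c)"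
    using assms by (simp add: algebra_simps power2_eq_square power3_eq_cube)
  also have "\<dots> \<le> (1 - c + c\<^sup>2) * exp c"
    using assms by (intro mult_left_mono) auto
  finally have "exp (- c) \<le> 1 - c + c\<^sup>2" by (simp add: exp_minus field_simps)
  moreover have "exp (c * P / (1 - P)) \<le> 1 + c * P / (1 - P) + (c * P / (1 - P))\<^sup>2"
    using exp_bound d by blast
  ultimately have "P * exp (- c) + (1 - P) * exp (c * P / (1 - P))
      \<le> P * (1 - c + c\<^sup>2) + (1 - P) * (1 + c * P / (1 - P) + (c * P / (1 - P))\<^sup>2)"
    using assms by (intro add_mono mult_left_mono) auto
  also have "\<dots> = 1 + c\<^sup>2 * P / (1 - P)"
  proof -
    define r where "r = P / (1 - P)"
    have r: "(1 - P) * r = P" using assms by (simp add: r_def)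
    have "P * (1 - c + c\<^sup>2) + (1 - P) * (1 + c * r + (c * r)\<^sup>2) = 1 + c\<^sup>2 * r"
    proof -
      have "(1 - P) * (1 + c * r + (c * r)\<^sup>2)
          = 1 - P + c * ((1 - P) * r) + c\<^sup>2 * r * ((1 - P) * r)"
        by (simp add: algebra_simps power2_eq_square)
      also have "\<dots> = 1 - P + c * P + c\<^sup>2 * (P * r)" unfolding r by simp
      also have "P * r = r - P" using r by (simp add: algebra_simps)
      finally show ?thesis by (simp add: algebra_simps)
    qed
    then show ?thesis by (simp add: r_def)
  qed
  also have "\<dots> \<le> exp (c\<^sup>2 * P / (1 - P))" by simp
  finally show ?thesis .
qed

lemma inverse_square_update_mono:
  assumes "valid \<theta> s" "e \<noteq> {}"
  shows "1 / (snd s a)\<^sup>2 \<le> 1 / (snd (update p \<theta> s e b) a)\<^sup>2"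
proof -
  have "snd (update p \<theta> s e b) a \<le> snd s a"
    using accept_prob_bounds[OF assms] validD[OF assms(1), of a]
    by (simp add: update_def mult_left_le)
  then show ?thesis
    using validD[OF valid_update[OF assms, of b], of a] by (intro frac_le power_mono) auto
qed

text \<open>If \<open>P\<close> is nonzero, \<open>1 - F v\<close> grows by
  \<open>F v * P = p * weight s a\<close>, exactly the term that leaves the sum; otherwise only the
  nonnegative term is lost. The sum over \<open>N\<close> does not decrease. No averaging over the
  decision is needed.\<close>

lemma potential_step_incident:
  assumes s: "valid \<theta> s" and e: "e = {v, a}" "v \<noteq> a" "e \<notin> set rest"
    and c: "\<forall>f\<in>set rest. card f = 2" and \<mu>: "0 \<le> \<mu>"
  shows "potential \<mu> v N rest (update p \<theta> s e b) \<le> potential \<mu> v N (e # rest) s"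
proof -
  have ne: "e \<noteq> {}" using e by simp
  define R where "R = {x. {v, x} \<in> set rest}"
  have R: "v \<notin> R" "a \<notin> R" using c e by (auto simp: R_def)
  have "inj_on (\<lambda>x. {v, x}) R" by (auto simp: inj_on_def doubleton_eq_iff)
  moreover have "(\<lambda>x. {v, x}) ` R \<subseteq> set rest" by (auto simp: R_def)
  ultimately have fin: "finite R" by (meson List.finite_set inj_on_finite)
  have R': "{x. {v, x} \<in> set (e # rest)} = insert a R"
    using e by (auto simp: R_def doubleton_eq_iff)
  have "snd s v * accept_prob p \<theta> s e \<le> p * weight s a"
  proof (cases "accept_prob p \<theta> s e = 0")
    case True
    then show ?thesis using p weight_nonneg[OF s] by simp
  next
    case False
    then have "e \<inter> fst s = {}" "accept_prob p \<theta> s e = p / (\<Prod>x\<in>e. snd s x)"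
      by (auto simp: accept_prob_def Let_def split: if_splits)
    then show ?thesis using e validD[OF s, of v] by (simp add: weight_def)
  qed
  moreover have "(\<Sum>x\<in>R. weight (update p \<theta> s e b) x) = (\<Sum>x\<in>R. weight s x)"
    using R e by (intro sum.cong) (auto intro!: weight_update_other)
  ultimately have "gap v rest (update p \<theta> s e b) \<le> gap v (e # rest) s"
    unfolding gap_def R' using fin R e
    by (simp add: R_def[symmetric] update_def algebra_simps)
  moreover have "(\<Sum>x\<in>N. 1 / (snd s x)\<^sup>2) \<le> (\<Sum>x\<in>N. 1 / (snd (update p \<theta> s e b) x)\<^sup>2)"
    by (intro sum_mono inverse_square_update_mono s ne)
  ultimately show ?thesis
    unfolding potential_def using \<mu> by (auto intro!: diff_mono mult_left_mono)
qed

text \<open>Away from \<open>v\<close>, the gap moves only through the at most two endpoints in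
  \<open>R\<close>: down by \<open>p * S\<close> on acceptance, up by
  \<open>p * S * P / (1 - P)\<close> on rejection. This is the two-point variable scaled by
  \<open>\<mu>\<close>, and the growth of the sum over \<open>N\<close> pays for its
  variance.\<close>

lemma potential_step_other:
  assumes s: "valid \<theta> s" and e: "card e = 2" "v \<notin> e"
    and N: "finite N" "{a. {v, a} \<in> set rest} \<subseteq> N"
    and \<mu>: "0 \<le> \<mu>" "2 * \<mu> * p \<le> \<theta>"
  shows "accept_prob p \<theta> s e * potential \<mu> v N rest (update p \<theta> s e True)
      + (1 - accept_prob p \<theta> s e) * potential \<mu> v N rest (update p \<theta> s e False)
    \<le> potential \<mu> v N (e # rest) s"
proof -
  define P where "P = accept_prob p \<theta> s e"
  define R where "R = {a. {v, a} \<in> set rest}"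
  have ne: "e \<noteq> {}" and fe: "finite e" using e by (auto intro: card_ge_0_finite)
  have P: "0 \<le> P" "P < 1" using accept_prob_bounds[OF s ne] by (auto simp: P_def)
  have R': "{a. {v, a} \<in> set (e # rest)} = R" using e by (auto simp: R_def)
  have fR: "finite R" using N finite_subset by (auto simp: R_def)
  show ?thesis
  proof (cases "P = 0")
    case True
    then show ?thesis
      using R' by (simp add: P_def update_False_eq potential_def gap_def R_def)
  next
    case False
    then have free: "e \<inter> fst s = {}"
      by (auto simp: P_def accept_prob_def Let_def split: if_splits)
    define S where "S = (\<Sum>a\<in>R \<inter> e. weight s a)"
    define T where "T = (\<Sum>a\<in>R \<inter> e. 1 / (snd s a)\<^sup>2)"
    define Q where "Q = (\<Sum>a\<in>N. 1 / (snd s a)\<^sup>2)"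
    define Q' where "Q' = (\<Sum>a\<in>N. 1 / (snd (update p \<theta> s e True) a)\<^sup>2)"
    define c where "c = \<mu> * p * S"
    define G where "G = gap v (e # rest) s"
    have split: "(\<Sum>a\<in>R. f a) = (\<Sum>a\<in>R - e. f a) + (\<Sum>a\<in>R \<inter> e. f a)" for f :: "nat \<Rightarrow> real"
      using sum.Int_Diff[OF fR, of f e] by simp
    have keep: "(\<Sum>a\<in>R - e. weight (update p \<theta> s e b) a) = (\<Sum>a\<in>R - e. weight s a)" for b
      by (intro sum.cong) (auto intro!: weight_update_other)
    have G: "G = 1 - snd s v + p * ((\<Sum>a\<in>R - e. weight s a) + S)"
      unfolding G_def gap_def R' split S_def ..
    have Fv: "snd (update p \<theta> s e b) v = snd s v" for b using e by (simp add: update_def)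
    have G1: "gap v rest (update p \<theta> s e True) = G - p * S"
      unfolding gap_def R_def[symmetric] split keep Fv G
      by (simp add: weight_update_True algebra_simps)
    have weight_sum: "(\<Sum>a\<in>R \<inter> e. weight (update p \<theta> s e False) a) = S / (1 - P)"
      unfolding S_def P_def sum_divide_distrib
      by (intro sum.cong) (auto simp: weight_update_False)
    also have "\<dots> = S + S * P / (1 - P)" using P by (simp add: field_simps)
    finally have G2: "gap v rest (update p \<theta> s e False) = G + p * (S * P / (1 - P))"
      unfolding gap_def R_def[symmetric] split keep Fv G by (simp add: algebra_simps)
    have Q'_False: "Q' = (\<Sum>a\<in>N. 1 / (snd (update p \<theta> s e False) a)\<^sup>2)"
      by (simp add: Q'_def update_def)
    have card: "card (R \<inter> e) \<le> 2"
      using e(1) card_mono[OF fe, of "R \<inter> e"] by simp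
    \<comment> \<open>Cauchy-Schwarz over at most two terms; since \<open>e\<close> is free, the
      squared weights are the terms of \<open>T\<close>.\<close>
    have S2: "S\<^sup>2 \<le> 2 * T"
    proof -
      have "S\<^sup>2 \<le> (\<Sum>a\<in>R \<inter> e. (weight s a)\<^sup>2) * card (R \<inter> e)"
        unfolding S_def by (rule sum_squared_le_sum_of_squares)
      also have "(\<Sum>a\<in>R \<inter> e. (weight s a)\<^sup>2) = T"
        unfolding T_def using free
        by (intro sum.cong) (auto simp: weight_def power_divide)
      also have "T * card (R \<inter> e) \<le> T * 2"
        using card by (intro mult_left_mono) (auto simp: T_def intro: sum_nonneg)
      finally show ?thesis by simp
    qed
    have S0: "0 \<le> S" unfolding S_def by (intro sum_nonneg weight_nonneg s)
    \<comment> \<open>The left side is the weight sum after a rejection, whose terms are at most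
      \<open>1 / \<theta>\<close> because the updated state is valid. This gives
      \<open>c \<le> 1 - P\<close> and not merely \<open>c \<le> 1\<close>.\<close>
    have "S / (1 - P) \<le> 2 / \<theta>"
    proof -
      have "S / (1 - P) = (\<Sum>a\<in>R \<inter> e. weight (update p \<theta> s e False) a)"
        by (rule weight_sum[symmetric])
      also have "\<dots> \<le> real (card (R \<inter> e)) * (1 / \<theta>)"
        by (intro sum_bounded_above weight_le valid_update s ne)
      also have "\<dots> \<le> 2 * (1 / \<theta>)"
        using card \<theta> by (intro mult_right_mono) auto
      finally show ?thesis by simp
    qed
    then have "\<mu> * p * (S / (1 - P)) \<le> \<mu> * p * (2 / \<theta>)"
      using \<mu> p by (intro mult_left_mono) auto
    also have "\<dots> \<le> 1" using \<mu> \<theta> by (simp add: field_simps)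
    finally have c: "0 \<le> c" "c \<le> 1 - P"
      using P S0 p \<mu> by (auto simp: c_def field_simps)
    \<comment> \<open>Each \<open>1 / (F a)^2\<close> with \<open>a\<close> in \<open>e\<close> is
      divided by \<open>(1 - P)^2\<close>, a relative growth of at least
      \<open>2 * P / (1 - P)\<close>. The factor \<open>2\<close> matches the one lost in
      \<open>S2\<close>.\<close>
    have QT: "2 * P / (1 - P) * T \<le> Q' - Q"
    proof -
      have "2 * P / (1 - P) * T
          = (\<Sum>a\<in>R \<inter> e. 2 * P / (1 - P) * (1 / (snd s a)\<^sup>2))"
        by (simp add: T_def sum_distrib_left)
      also have "\<dots> \<le> (\<Sum>a\<in>R \<inter> e. 1 / (snd (update p \<theta> s e True) a)\<^sup>2 - 1 / (snd s a)\<^sup>2)"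
      proof (intro sum_mono)
        fix a assume a: "a \<in> R \<inter> e"
        have "1 + 2 * P / (1 - P) \<le> 1 / (1 - P)\<^sup>2"
        proof -
          have "1 + 2 * P / (1 - P) = (1 + P) / (1 - P)" using P by (simp add: field_simps)
          also have "\<dots> = ((1 + P) * (1 - P)) / ((1 - P) * (1 - P))" using P by simp
          also have "\<dots> = (1 - P\<^sup>2) / (1 - P)\<^sup>2"
            by (simp add: algebra_simps power2_eq_square)
          also have "\<dots> \<le> 1 / (1 - P)\<^sup>2" by (intro divide_right_mono) auto
          finally show ?thesis .
        qed
        then have "(1 + 2 * P / (1 - P)) * (1 / (snd s a)\<^sup>2) \<le> 1 / (1 - P)\<^sup>2 * (1 / (snd s a)\<^sup>2)"
          by (intro mult_right_mono) auto
        also have "\<dots> = 1 / (snd (update p \<theta> s e True) a)\<^sup>2"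
          using a by (simp add: update_def P_def power_mult_distrib)
        finally show "2 * P / (1 - P) * (1 / (snd s a)\<^sup>2)
            \<le> 1 / (snd (update p \<theta> s e True) a)\<^sup>2 - 1 / (snd s a)\<^sup>2"
          by (simp add: algebra_simps)
      qed
      also have "\<dots> \<le> (\<Sum>a\<in>N. 1 / (snd (update p \<theta> s e True) a)\<^sup>2 - 1 / (snd s a)\<^sup>2)"
        using N inverse_square_update_mono[OF s ne] by (intro sum_mono2) (auto simp: R_def)
      also have "\<dots> = Q' - Q" by (simp add: Q_def Q'_def sum_subtractf)
      finally show ?thesis .
    qed
    have "c\<^sup>2 * P / (1 - P) = (\<mu> * p)\<^sup>2 * (P / (1 - P) * S\<^sup>2)"
      by (simp add: c_def power_mult_distrib)
    also have "\<dots> \<le> (\<mu> * p)\<^sup>2 * (P / (1 - P) * (2 * T))"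
      using P S2 by (intro mult_left_mono) auto
    also have "\<dots> \<le> (\<mu> * p)\<^sup>2 * (Q' - Q)"
      using QT by (intro mult_left_mono) (auto simp: mult_ac)
    finally have cQ: "c\<^sup>2 * P / (1 - P) \<le> (\<mu> * p)\<^sup>2 * (Q' - Q)" .
    have "P * potential \<mu> v N rest (update p \<theta> s e True)
        + (1 - P) * potential \<mu> v N rest (update p \<theta> s e False)
      = exp (\<mu> * G - (\<mu> * p)\<^sup>2 * Q') * (P * exp (- c) + (1 - P) * exp (c * P / (1 - P)))"
    proof -
      have "\<mu> * (G - p * S) - (\<mu> * p)\<^sup>2 * Q' = (\<mu> * G - (\<mu> * p)\<^sup>2 * Q') + - c"
        "\<mu> * (G + p * (S * P / (1 - P))) - (\<mu> * p)\<^sup>2 * Q'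
          = (\<mu> * G - (\<mu> * p)\<^sup>2 * Q') + c * P / (1 - P)"
        by (simp_all add: c_def algebra_simps)
      then show ?thesis
        unfolding potential_def G1 G2 Q'_def[symmetric] Q'_False[symmetric]
        by (simp only: exp_add) (simp add: algebra_simps)
    qed
    also have "\<dots> \<le> exp (\<mu> * G - (\<mu> * p)\<^sup>2 * Q') * exp ((\<mu> * p)\<^sup>2 * (Q' - Q))"
      using exp_two_point_bound[OF P c] cQ by (intro mult_left_mono) (auto intro: order_trans)
    also have "\<dots> = potential \<mu> v N (e # rest) s"
      by (simp add: potential_def G_def Q_def flip: exp_add) (simp add: algebra_simps)
    finally show ?thesis by (simp add: P_def)
  qed
qed

lemma potential_step:
  assumes s: "valid \<theta> s" and e: "distinct (e # rest)" "\<forall>f\<in>set (e # rest). card f = 2"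
    and N: "finite N" "{a. {v, a} \<in> set rest} \<subseteq> N"
    and \<mu>: "0 \<le> \<mu>" "2 * \<mu> * p \<le> \<theta>"
  shows "accept_prob p \<theta> s e * potential \<mu> v N rest (update p \<theta> s e True)
      + (1 - accept_prob p \<theta> s e) * potential \<mu> v N rest (update p \<theta> s e False)
    \<le> potential \<mu> v N (e # rest) s"
proof (cases "v \<in> e")
  case True
  have "card e = 2" using e by simp
  then obtain a where a: "e = {v, a}" "v \<noteq> a"
    using True by (auto simp: card_2_iff doubleton_eq_iff)
  have "e \<noteq> {}" using a by simp
  note b = accept_prob_bounds[OF s this]
  have *: "potential \<mu> v N rest (update p \<theta> s e b) \<le> potential \<mu> v N (e # rest) s" for b
    using potential_step_incident[OF s a] e \<mu> by simp
  show ?thesis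
    using convex_bound_le[OF *[of True] *[of False], of "accept_prob p \<theta> s e" "1 - accept_prob p \<theta> s e"] b
    by simp
next
  case False
  then show ?thesis using potential_step_other assms by simp
qed

text \<open>A Chernoff bound: the exponential is at least \<open>1\<close> once the gap exceeds
  \<open>1 - \<theta>\<close>, so it replaces the indicator of a suspension at
  \<open>v\<close>.\<close>

lemma expect_exp_gap_le:
  assumes es: "distinct (es @ es')" "\<forall>f\<in>set (es @ es'). card f = 2"
    and N: "finite N" "{a. {v, a} \<in> set (es @ es')} = N" "card N \<le> d"
    and \<mu>: "0 \<le> \<mu>" "2 * \<mu> * p \<le> \<theta>" and "\<theta> \<le> 1"
  shows "expect p \<theta> (\<lambda>s. exp (\<mu> * (gap v es' s - (1 - \<theta>)))) ({}, \<lambda>_. 1) es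
    \<le> exp (\<mu> * (p * d - 1 + \<theta>) + (\<mu> * p)\<^sup>2 * d / \<theta>\<^sup>2)"
proof -
  let ?s = "({}, \<lambda>_. 1) :: state"
  \<comment> \<open>On valid states the sum over \<open>N\<close> is at most
    \<open>d / \<theta>^2\<close>; \<open>K\<close> restores this worst case and subtracts the
    threshold.\<close>
  define K where "K = (\<mu> * p)\<^sup>2 * d / \<theta>\<^sup>2 - \<mu> * (1 - \<theta>)"
  have s: "valid \<theta> ?s" using assms(8) by (simp add: valid_def)
  have ne: "{} \<notin> set es" using es(2) by (metis UnI1 card.empty set_append zero_neq_numeral)
  have "expect p \<theta> (\<lambda>s. exp (\<mu> * (gap v es' s - (1 - \<theta>)))) ?s es
      \<le> expect p \<theta> (\<lambda>s. exp K * potential \<mu> v N es' s) ?s es"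
  proof (rule expect_mono[OF s ne])
    fix s assume s: "valid \<theta> s"
    have "(\<Sum>a\<in>N. 1 / (snd s a)\<^sup>2) \<le> real (card N) * (1 / \<theta>\<^sup>2)"
      using validD[OF s] \<theta> by (intro sum_bounded_above frac_le power_mono) auto
    also have "\<dots> \<le> d * (1 / \<theta>\<^sup>2)" using N(3) by (intro mult_right_mono) auto
    finally have "(\<mu> * p)\<^sup>2 * (\<Sum>a\<in>N. 1 / (snd s a)\<^sup>2) \<le> (\<mu> * p)\<^sup>2 * (d * (1 / \<theta>\<^sup>2))"
      by (intro mult_left_mono) auto
    then show "exp (\<mu> * (gap v es' s - (1 - \<theta>))) \<le> exp K * potential \<mu> v N es' s"
      by (simp add: potential_def K_def algebra_simps flip: exp_add)
  qed
  also have "\<dots> = exp K * expect p \<theta> (potential \<mu> v N es') ?s es"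
    by (rule expect_cmult)
  also have "\<dots> \<le> exp K * potential \<mu> v N (es @ es') ?s"
  proof (intro mult_left_mono expect_supermartingale[OF s ne es(1)])
    fix s e rest
    assume "valid \<theta> s" "e \<in> set es" "distinct (e # rest)" "set (e # rest) \<subseteq> set (es @ es')"
    then show "accept_prob p \<theta> s e * potential \<mu> v N rest (update p \<theta> s e True)
      + (1 - accept_prob p \<theta> s e) * potential \<mu> v N rest (update p \<theta> s e False)
      \<le> potential \<mu> v N (e # rest) s"
      using es(2) N \<mu> by (intro potential_step) auto
  qed simp
  also have "\<dots> \<le> exp K * exp (\<mu> * (p * d))"
  proof -
    have "gap v (es @ es') ?s = p * card N"
      by (simp only: gap_def N(2)) (simp add: weight_def)
    also have "\<dots> \<le> p * d" using N(3) p by simp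
    finally have "\<mu> * gap v (es @ es') ?s \<le> \<mu> * (p * d)" using \<mu> by (intro mult_left_mono)
    moreover have "0 \<le> (\<mu> * p)\<^sup>2 * (\<Sum>a\<in>N. 1 / (snd ?s a)\<^sup>2)"
      by (intro mult_nonneg_nonneg sum_nonneg) auto
    ultimately have "\<mu> * gap v (es @ es') ?s - (\<mu> * p)\<^sup>2 * (\<Sum>a\<in>N. 1 / (snd ?s a)\<^sup>2) \<le> \<mu> * (p * d)"
      by linarith
    then show ?thesis unfolding potential_def by (intro mult_left_mono) auto
  qed
  also have "\<dots> = exp (\<mu> * (p * d - 1 + \<theta>) + (\<mu> * p)\<^sup>2 * d / \<theta>\<^sup>2)"
    by (simp add: K_def algebra_simps flip: exp_add)
  finally show ?thesis .
qed

section \<open>From rare suspensions to a lower bound for every edge\<close>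

text \<open>If an endpoint is matched, the product of weights is \<open>0\<close>. If both are free
  and the test passes, equality holds up to the subtracted error. If the test fails at
  \<open>x\<close>, the gap of \<open>x\<close> exceeds \<open>1 - \<theta>\<close>, so the error is
  at least \<open>p / \<theta>^2\<close>, which bounds \<open>p\<close> times the product.\<close>

lemma accept_prob_ge:
  assumes s: "valid \<theta> s" and uv: "u \<noteq> v" and \<mu>: "0 \<le> \<mu>"
  shows "p * (weight s u * weight s v)
      - p / \<theta>\<^sup>2 * (exp (\<mu> * (gap u ({u, v} # es) s - (1 - \<theta>)))
          + exp (\<mu> * (gap v ({u, v} # es) s - (1 - \<theta>))))
    \<le> accept_prob p \<theta> s {u, v}"
proof -
  let ?P = "p / (snd s u * snd s v)"
  let ?X = "\<lambda>x. exp (\<mu> * (gap x ({u, v} # es) s - (1 - \<theta>)))"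
  have acc: "accept_prob p \<theta> s {u, v} = (if {u, v} \<inter> fst s = {} \<and>
      \<theta> \<le> snd s u * (1 - ?P) \<and> \<theta> \<le> snd s v * (1 - ?P) then ?P else 0)"
    using uv by (simp add: accept_prob_def Let_def)
  \<comment> \<open>The arriving edge still counts as remaining, so its own term is in the
    sum.\<close>
  have gap_ge: "1 - snd s x + p * weight s y \<le> gap x ({u, v} # es) s" if "{x, y} = {u, v}" for x y
  proof -
    have "inj_on (\<lambda>a. {x, a}) {a. {x, a} \<in> set ({u, v} # es)}"
      by (auto simp: inj_on_def doubleton_eq_iff)
    moreover have "(\<lambda>a. {x, a}) ` {a. {x, a} \<in> set ({u, v} # es)} \<subseteq> set ({u, v} # es)" by blast
    ultimately have "finite {a. {x, a} \<in> set ({u, v} # es)}"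
      by (meson List.finite_set inj_on_finite)
    then have "weight s y \<le> (\<Sum>a | {x, a} \<in> set ({u, v} # es). weight s a)"
      using that by (intro member_le_sum weight_nonneg s) auto
    then show ?thesis using p by (simp add: gap_def)
  qed
  have large: "1 \<le> ?X x" if "{x, y} = {u, v}" "y \<notin> fst s" "snd s x * (1 - ?P) < \<theta>" for x y
  proof -
    have "?P = p / (snd s x * snd s y)"
      using that(1) by (auto simp: doubleton_eq_iff mult.commute)
    moreover have "0 < snd s x" using validD[OF s] by blast
    ultimately have "snd s x * ?P = p * weight s y"
      using that(2) by (simp only: weight_def) simp
    moreover have "snd s x * (1 - ?P) = snd s x - snd s x * ?P"
      by (simp only: right_diff_distrib mult_1_right)
    ultimately have "1 - \<theta> < 1 - snd s x + p * weight s y"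
      using that(3) by linarith
    also have "\<dots> \<le> gap x ({u, v} # es) s" by (rule gap_ge) fact
    finally show ?thesis using \<mu> by simp
  qed
  have X: "0 < ?X x" for x by simp
  have le: "p * (weight s u * weight s v) \<le> p / \<theta>\<^sup>2"
  proof -
    have "weight s u * weight s v \<le> 1 / \<theta> * (1 / \<theta>)"
      using \<theta> by (intro mult_mono weight_le weight_nonneg s) auto
    from mult_left_mono[OF this, of p] show ?thesis using p by (simp add: power2_eq_square)
  qed
  have pos: "0 \<le> p / \<theta>\<^sup>2" using p by simp
  have nonneg: "0 \<le> accept_prob p \<theta> s {u, v}" using accept_prob_bounds[OF s] by simp
  have err: "0 \<le> p / \<theta>\<^sup>2 * (?X u + ?X v)"
    using pos X[of u] X[of v] by (intro mult_nonneg_nonneg) linarith+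
  consider "p * (weight s u * weight s v) = accept_prob p \<theta> s {u, v}"
    | "1 \<le> ?X u + ?X v" | "weight s u * weight s v = 0"
  proof (cases "{u, v} \<inter> fst s = {}")
    case True
    consider "\<theta> \<le> snd s u * (1 - ?P) \<and> \<theta> \<le> snd s v * (1 - ?P)"
      | "snd s u * (1 - ?P) < \<theta>" | "snd s v * (1 - ?P) < \<theta>"
      by linarith
    then show ?thesis
    proof cases
      case 1
      then have "accept_prob p \<theta> s {u, v} = ?P" using acc True by presburger
      then show ?thesis using True by (intro that(1)) (simp add: weight_def)
    next
      case 2
      then have "1 \<le> ?X u" using True by (intro large[of u v]) auto
      then show ?thesis using X[of v] by (intro that(2)) linarith
    next
      case 3
      then have "1 \<le> ?X v" using True by (intro large[of v u]) auto
      then show ?thesis using X[of u] by (intro that(2)) linarith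
    qed
  next
    case False
    then show ?thesis using that(3) by (auto simp: weight_def)
  qed
  then show ?thesis
  proof cases
    case 1
    then show ?thesis using err by linarith
  next
    case 2
    then have "p / \<theta>\<^sup>2 * 1 \<le> p / \<theta>\<^sup>2 * (?X u + ?X v)" using pos by (intro mult_left_mono)
    then show ?thesis using le nonneg by linarith
  next
    case 3
    then show ?thesis using err nonneg by (simp only: mult_zero_right)
  qed
qed

text \<open>The product of weights starts at \<open>1\<close> and keeps its mean, giving the main
  term \<open>p\<close>. The gap starts at most at \<open>p * d\<close>, a margin
  \<open>\<theta>\<close> below \<open>1 - \<theta>\<close>, whence the exponent
  \<open>- \<mu> * \<theta>\<close>; \<open>small\<close> limits the loss at both endpoints to
  \<open>p * \<delta>\<close>.\<close>

lemma prob_accepted_ge: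
  assumes E: "\<forall>f\<in>set es. card f = 2" "distinct es" "e \<in> set es"
    and d: "\<And>v. degree (set es) v \<le> d"
    and \<mu>: "0 \<le> \<mu>" "2 * \<mu> * p \<le> \<theta>" and \<theta>1: "\<theta> \<le> 1" and pd: "p * d \<le> 1 - 2 * \<theta>"
    and small: "2 * exp (- \<mu> * \<theta> + (\<mu> * p)\<^sup>2 * d / \<theta>\<^sup>2) \<le> \<delta> * \<theta>\<^sup>2"
  shows "p * (1 - \<delta>) \<le> measure_pmf.prob (run (natural_step p \<theta>) [] es) {h. e \<in> accepted h}"
proof -
  let ?s = "({}, \<lambda>_. 1) :: state"
  have s: "valid \<theta> ?s" using \<theta>1 by (simp add: valid_def)
  obtain es1 es2 where es: "es = es1 @ e # es2" using E(3) by (meson split_list)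
  obtain u v where e: "e = {u, v}" "u \<noteq> v" using E(1,3) by (meson card_2_iff)
  have ne: "{} \<notin> set es" using E(1) by auto
  let ?X = "\<lambda>x s. exp (\<mu> * (gap x (e # es2) s - (1 - \<theta>)))"
  define B where "B = exp (- \<mu> * \<theta> + (\<mu> * p)\<^sup>2 * d / \<theta>\<^sup>2)"
  have X: "expect p \<theta> (?X x) ?s es1 \<le> B" for x
  proof -
    let ?N = "{a. {x, a} \<in> set es}"
    have inj: "inj_on (\<lambda>a. {x, a}) ?N" by (auto simp: inj_on_def doubleton_eq_iff)
    have sub: "(\<lambda>a. {x, a}) ` ?N \<subseteq> {f \<in> set es. x \<in> f}" by auto
    have fin: "finite ?N" using inj sub by (rule inj_on_finite) simp
    have "card ?N \<le> degree (set es) x"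
      unfolding degree_def using inj sub by (rule card_inj_on_le) simp
    with d[of x] have "card ?N \<le> d" by linarith
    then have "expect p \<theta> (?X x) ?s es1 \<le> exp (\<mu> * (p * d - 1 + \<theta>) + (\<mu> * p)\<^sup>2 * d / \<theta>\<^sup>2)"
      using E fin \<mu> \<theta>1 unfolding es by (intro expect_exp_gap_le[where N = ?N]) (auto simp: es)
    also have "\<mu> * (p * d - 1 + \<theta>) \<le> \<mu> * (- \<theta>)" using pd \<mu> by (intro mult_left_mono) auto
    then have "exp (\<mu> * (p * d - 1 + \<theta>) + (\<mu> * p)\<^sup>2 * d / \<theta>\<^sup>2) \<le> B" by (simp add: B_def)
    finally show ?thesis .
  qed
  have "p * (1 - \<delta>) \<le> p - p / \<theta>\<^sup>2 * (B + B)"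
  proof -
    have "2 * B / \<theta>\<^sup>2 \<le> \<delta>" using small \<theta> by (subst pos_divide_le_eq) (auto simp: B_def)
    then have "p * (2 * B / \<theta>\<^sup>2) \<le> p * \<delta>" using p by (intro mult_left_mono) auto
    then show ?thesis by (simp add: algebra_simps)
  qed
  also have "\<dots> \<le> p * (weight ?s u * weight ?s v)
      - p / \<theta>\<^sup>2 * (expect p \<theta> (?X u) ?s es1 + expect p \<theta> (?X v) ?s es1)"
    using X[of u] X[of v] p by (intro diff_mono mult_left_mono add_mono) (auto simp: weight_def)
  also have "\<dots> = p * expect p \<theta> (\<lambda>s. weight s u * weight s v) ?s es1
      - p / \<theta>\<^sup>2 * (expect p \<theta> (?X u) ?s es1 + expect p \<theta> (?X v) ?s es1)"
    using E e by (subst expect_weight_mult[OF s]) (auto simp: es)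
  also have "\<dots> = expect p \<theta> (\<lambda>s. p * (weight s u * weight s v)
      + (- (p / \<theta>\<^sup>2)) * (?X u s + ?X v s)) ?s es1"
    unfolding expect_add expect_cmult by simp
  also have "\<dots> \<le> expect p \<theta> (\<lambda>s. accept_prob p \<theta> s e) ?s es1"
  proof (rule expect_mono[OF s])
    show "{} \<notin> set es1" using ne by (simp add: es)
  next
    fix s assume s: "valid \<theta> s"
    from accept_prob_ge[OF this e(2) \<mu>(1), of es2]
    show "p * (weight s u * weight s v) + (- (p / \<theta>\<^sup>2)) * (?X u s + ?X v s) \<le> accept_prob p \<theta> s e"
      unfolding e(1) by linarith
  qed
  also have "\<dots> = measure_pmf.prob (run (natural_step p \<theta>) [] es) {h. e \<in> accepted h}"
    using prob_accepted_eq_expect[of "[]" es1 e es2] s ne E(2) by (simp add: es)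
  finally show ?thesis .
qed

end

section \<open>Choice of parameters and small degrees\<close>

definition greedy_step :: "history \<Rightarrow> edge \<Rightarrow> bool pmf" where
  "greedy_step h e = return_pmf (\<forall>f\<in>accepted h. e \<inter> f = {})"

lemma greedy_accepts_disjoint:
  assumes "h' \<in> set_pmf (run greedy_step h es)" "distinct es"
    and "\<forall>e\<in>accepted h \<union> set es. \<forall>f\<in>accepted h \<union> set es. e \<noteq> f \<longrightarrow> e \<inter> f = {}"
    and "accepted h \<inter> set es = {}"
  shows "set es \<subseteq> accepted h'"
  using assms
proof (induction es arbitrary: h)
  case Nil
  then show ?case by simp
next
  case (Cons e es)
  have "\<forall>f\<in>accepted h. e \<inter> f = {}"
    using Cons.prems(3,4) by auto
  then have h': "h' \<in> set_pmf (run greedy_step (h @ [(e, True)]) es)"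
    using Cons.prems(1) by (simp add: greedy_step_def[of h e] bind_return_pmf)
  have acc: "accepted (h @ [(e, True)]) = insert e (accepted h)"
    by (auto simp: accepted_def)
  have "set es \<subseteq> accepted h'"
    using Cons.prems by (intro Cons.IH[OF h']) (auto simp: acc)
  moreover have "e \<in> accepted h'"
    using set_pmf_run[OF h'] by (auto simp: accepted_def)
  ultimately show ?case by simp
qed

text \<open>This is the value used for \<open>\<theta>\<close>. With the factor \<open>2\<close>,
  its fourth power is \<open>16 * (ln d)^2 / d\<close>, so the optimised exponent is at most
  \<open>- 4 * (ln d)^2\<close>.\<close>

definition slack :: "nat \<Rightarrow> real" where
  "slack d = 2 * real d powr (- 1 / 4) * sqrt (ln (real d))"

text \<open>
  For \<open>d = 1\<close> the slack vanishes and the target probability is \<open>1\<close>. If \<open>d\<close> is so small that the slack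
  exceeds \<open>1 / 6\<close>, any probability of order \<open>1 / d\<close> suffices.
\<close>

definition natural_alg :: online_alg where
  "natural_alg d =
     (if d \<le> 1 then greedy_step
      else if slack d \<le> 1 / 6 then natural_step ((1 - 2 * slack d) / d) (slack d)
      else natural_step (1 / (128 * d)) (1 / 4))"

lemma online_matching_natural_alg: "online_matching_alg natural_alg"
  unfolding online_matching_alg_def natural_alg_def
  by (auto simp: natural_step_respects_matching greedy_step_def)

lemma half_le_ln:
  assumes "2 \<le> d" shows "1 / 2 \<le> ln (real d)"
proof -
  have "ln (1 / 2 :: real) \<le> 1 / 2 - 1" by (rule ln_le_minus_one) simp
  then have "1 / 2 \<le> ln (2 :: real)" by (simp add: ln_div)
  also have "\<dots> \<le> ln (real d)" using assms by simp
  finally show ?thesis .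
qed

lemma slack_pos: "2 \<le> d \<Longrightarrow> 0 < slack d"
  using half_le_ln[of d] by (simp add: slack_def)

text \<open>With \<open>t = slack d\<close>, the exponent \<open>- \<mu> * t + \<mu>\<^sup>2 * p\<^sup>2 * d / t\<^sup>2\<close> is minimal at \<open>\<mu> = t^3 / (2 * p\<^sup>2 * d)\<close>.\<close>

lemma prob_accepted_ge_main:
  assumes E: "\<forall>f\<in>set es. card f = 2" "distinct es" "e \<in> set es"
    and deg: "\<And>v. degree (set es) v \<le> d" and d: "2 \<le> d" and t: "slack d \<le> 1 / 6"
  shows "(1 - 2 * slack d) / d * (1 - slack d)
    \<le> measure_pmf.prob (run (natural_step ((1 - 2 * slack d) / d) (slack d)) [] es) {h. e \<in> accepted h}"
proof -
  define t where "t = slack d"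
  define p where "p = (1 - 2 * t) / d"
  define \<mu> where "\<mu> = t ^ 3 / (2 * p\<^sup>2 * d)"
  have t0: "0 < t" "t \<le> 1 / 6" using slack_pos[OF d] t by (auto simp: t_def)
  have p0: "0 < p" and pd: "p * d = 1 - 2 * t" and ple: "p \<le> 1 / d"
    using t0 d by (auto simp: p_def divide_right_mono)
  have ln0: "1 / 2 \<le> ln (real d)" by (rule half_le_ln[OF d])
  have t4: "t ^ 4 = 16 * (ln d)\<^sup>2 / d"
  proof -
    have "(real d powr (- 1 / 4)) ^ 4 = 1 / d"
      using d by (subst powr_power) (auto simp: powr_minus_divide)
    moreover have "sqrt (ln (real d)) ^ 4 = (ln d)\<^sup>2"
      using ln0 by (simp add: power4_eq_xxxx power2_eq_square)
    ultimately show ?thesis by (simp add: t_def slack_def power_mult_distrib)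
  qed
  \<comment> \<open>Needed for \<open>small\<close> with \<open>\<delta> = \<theta> = t\<close>,
    where the exponential will be at most \<open>1 / d^2\<close>. Here \<open>7 / 10\<close> is
    below \<open>sqrt (1 / 2)\<close>, and \<open>(2 * 7 / 10)^3 = 343 / 125\<close> exceeds
    \<open>2\<close>.\<close>
  have t3: "2 / (real d)\<^sup>2 \<le> t ^ 3"
  proof -
    have "7 / 10 \<le> sqrt (ln (real d))"
      using ln0 by (intro real_le_rsqrt) (simp add: power2_eq_square)
    then have "2 * real d powr (- 1 / 4) * (7 / 10) \<le> t"
      unfolding t_def slack_def by (intro mult_left_mono) auto
    then have "(2 * real d powr (- 1 / 4) * (7 / 10)) ^ 3 \<le> t ^ 3"
      by (intro power_mono) auto
    moreover have "(real d powr (- 1 / 4)) ^ 3 = real d powr (- 3 / 4)"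
      using d by (simp add: powr_power)
    moreover have "1 / (real d)\<^sup>2 \<le> real d powr (- 3 / 4)"
    proof -
      have "1 / (real d)\<^sup>2 = real d powr (- 2)" using d by (simp add: powr_minus_divide)
      also have "\<dots> \<le> real d powr (- 3 / 4)" using d by (intro powr_mono) auto
      finally show ?thesis .
    qed
    moreover have "2 / (real d)\<^sup>2 = 2 * (1 / (real d)\<^sup>2)" "0 \<le> 1 / (real d)\<^sup>2" by simp_all
    moreover have "(2 * real d powr (- 1 / 4) * (7 / 10)) ^ 3 = 343 / 125 * (real d powr (- 1 / 4)) ^ 3"
      by (simp add: power_mult_distrib power_divide)
    ultimately show ?thesis by linarith
  qed
  have mu: "\<mu> * t = t ^ 4 / (2 * p\<^sup>2 * d)" "(\<mu> * p)\<^sup>2 * d / t\<^sup>2 = t ^ 4 / (4 * p\<^sup>2 * d)"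
    using t0 p0 d by (simp_all add: \<mu>_def field_simps eval_nat_numeral)
  have "- \<mu> * t + (\<mu> * p)\<^sup>2 * d / t\<^sup>2 = - (t ^ 4 / (4 * p\<^sup>2 * d))"
    using mu p0 d by (simp add: field_simps)
  also have "\<dots> \<le> - (4 * (ln d)\<^sup>2)"
  proof -
    have "p\<^sup>2 \<le> (1 / d)\<^sup>2" using p0 ple by (intro power_mono) auto
    then have "4 * p\<^sup>2 * d \<le> 4 * (1 / d)\<^sup>2 * d" by (intro mult_right_mono mult_left_mono) auto
    then have "4 * p\<^sup>2 * d \<le> 4 / d" using d by (simp add: power2_eq_square)
    then have "t ^ 4 / (4 / d) \<le> t ^ 4 / (4 * p\<^sup>2 * d)" using p0 d by (intro divide_left_mono) auto
    then show ?thesis using d by (simp add: t4 field_simps)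
  qed
  also have "\<dots> \<le> - (2 * ln d)"
    using mult_right_mono[OF ln0, of "ln (real d)"] ln0 by (simp add: power2_eq_square)
  finally have "exp (- \<mu> * t + (\<mu> * p)\<^sup>2 * d / t\<^sup>2) \<le> exp (- (2 * ln d))" by simp
  also have "exp (- (2 * ln d)) = 1 / (real d)\<^sup>2"
    using d by (simp add: exp_minus exp_double divide_inverse)
  finally have small: "2 * exp (- \<mu> * t + (\<mu> * p)\<^sup>2 * d / t\<^sup>2) \<le> t * t\<^sup>2"
    using t3 by (simp add: power3_eq_cube power2_eq_square)
  have "2 * \<mu> * p = t\<^sup>2 / (p * d) * t"
    using p0 d by (simp add: \<mu>_def field_simps eval_nat_numeral)
  also have "\<dots> \<le> 1 * t"
  proof (intro mult_right_mono)
    have "t\<^sup>2 \<le> t * (1 / 6)" using t0 by (simp add: power2_eq_square)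
    then have "t\<^sup>2 \<le> p * d" using t0 by (simp add: pd)
    then show "t\<^sup>2 / (p * d) \<le> 1" using p0 d by simp
  qed (use t0 in simp)
  finally have mu': "2 * \<mu> * p \<le> t" by simp
  have "0 \<le> \<mu>" using t0 by (simp add: \<mu>_def)
  from prob_accepted_ge[OF p0 t0(1) E deg this mu' _ _ small]
  show ?thesis using t0 pd by (simp add: p_def t_def)
qed

text \<open>Take \<open>\<theta> = 1 / 4\<close>, \<open>\<delta> = 1 / 2\<close> and
  \<open>\<mu> = 16 * d\<close>. Then \<open>\<mu> * p = 1 / 8\<close>, so
  \<open>2 * \<mu> * p = \<theta>\<close> exactly, and the exponent \<open>- 15 / 4 * d\<close> is
  below \<open>- 6\<close>, while a factor \<open>1 / 2^6\<close> suffices.\<close>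

lemma prob_accepted_ge_crude:
  assumes E: "\<forall>f\<in>set es. card f = 2" "distinct es" "e \<in> set es"
    and deg: "\<And>v. degree (set es) v \<le> d" and d: "2 \<le> d"
  shows "1 / (256 * d)
    \<le> measure_pmf.prob (run (natural_step (1 / (128 * d)) (1 / 4)) [] es) {h. e \<in> accepted h}"
proof -
  let ?p = "1 / (128 * real d)" and ?\<mu> = "16 * real d"
  have "- ?\<mu> * (1 / 4) + (?\<mu> * ?p)\<^sup>2 * d / (1 / 4)\<^sup>2 = - (15 / 4) * d"
    using d by (simp add: power2_eq_square)
  then have "exp (- ?\<mu> * (1 / 4) + (?\<mu> * ?p)\<^sup>2 * d / (1 / 4)\<^sup>2) \<le> exp (- 6)"
    using d by simp
  also have "exp (- 6 :: real) = 1 / exp 1 ^ 6"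
    by (simp add: exp_minus divide_inverse flip: exp_of_nat_mult)
  also have "\<dots> \<le> 1 / 2 ^ 6"
    using exp_ge_add_one_self[of 1] by (intro divide_left_mono power_mono) auto
  finally have "2 * exp (- ?\<mu> * (1 / 4) + (?\<mu> * ?p)\<^sup>2 * d / (1 / 4)\<^sup>2) \<le> 1 / 2 * (1 / 4)\<^sup>2"
    by (simp add: power2_eq_square)
  then have "?p * (1 - 1 / 2)
      \<le> measure_pmf.prob (run (natural_step ?p (1 / 4)) [] es) {h. e \<in> accepted h}"
    using d by (intro prob_accepted_ge[OF _ _ E deg, where \<mu> = ?\<mu>]) auto
  then show ?thesis by simp
qed

lemma prob_natural_alg_ge:
  assumes G: "simple_graph V E" "arrival_order E es" "e \<in> E" and d: "max_degree V E = d"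
  shows "1 / (d * (1 + 2000 * slack d)) \<le> measure_pmf.prob (random_matching natural_alg d es) {M. e \<in> M}"
proof -
  have E: "\<forall>f\<in>set es. card f = 2" "distinct es" "e \<in> set es" and set: "set es = E"
    using G by (auto simp: simple_graph_def arrival_order_def)
  have fV: "finite V" and sub: "\<And>f. f \<in> E \<Longrightarrow> f \<subseteq> V" using G(1) by (auto simp: simple_graph_def)
  have fE: "finite E" using set by auto
  have deg: "degree (set es) v \<le> d" for v
  proof (cases "v \<in> V")
    case True
    then show ?thesis using fV d by (auto simp: max_degree_def set intro!: Max_ge)
  next
    case False
    then have "{e \<in> E. v \<in> e} = {}" using sub by auto
    then show ?thesis unfolding degree_def set by (metis card.empty le0)
  qed
  have prob: "measure_pmf.prob (random_matching natural_alg d es) {M. e \<in> M}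
      = measure_pmf.prob (run (natural_alg d) [] es) {h. e \<in> accepted h}"
    by (simp add: random_matching_def vimage_def)
  consider "d \<le> 1" | "2 \<le> d" "slack d \<le> 1 / 6" | "2 \<le> d" "1 / 6 < slack d" by linarith
  then show ?thesis
  proof cases
    case 1
    \<comment> \<open>Two edges sharing a vertex would give it degree at least
      \<open>2\<close>.\<close>
    have "x \<inter> y = {}" if "x \<in> E" "y \<in> E" "x \<noteq> y" for x y
    proof (rule ccontr)
      assume "x \<inter> y \<noteq> {}"
      then obtain v where "v \<in> x" "v \<in> y" by auto
      then have "card {x, y} \<le> degree (set es) v"
        using that fE unfolding degree_def set by (intro card_mono) auto
      then show False using deg[of v] 1 that(3) by simp
    qed
    then have "set es \<subseteq> accepted h'" if "h' \<in> set_pmf (run greedy_step [] es)" for h'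
      using that E(2) set by (intro greedy_accepts_disjoint) (auto simp: accepted_def)
    then have "measure_pmf.prob (run (natural_alg d) [] es) {h. e \<in> accepted h} = 1"
      using 1 E(3) by (subst measure_pmf.prob_eq_1) (auto simp: AE_measure_pmf_iff natural_alg_def)
    \<comment> \<open>For \<open>d = 0\<close> the bound is \<open>1 / 0 = 0\<close>; for
      \<open>d = 1\<close> it is \<open>1\<close>, as \<open>ln 1 = 0\<close>.\<close>
    moreover have "d = 0 \<or> d = 1" using 1 by linarith
    ultimately show ?thesis unfolding prob by (auto simp: slack_def)
  next
    case 2
    define t where "t = slack d"
    have t: "0 < t" "t \<le> 1 / 6" using slack_pos 2 by (auto simp: t_def)
    have "t * t \<le> t * (1 / 6)" "t * t * t \<ge> 0" using t by (auto intro: mult_left_mono)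
    moreover have "(1 - 2 * t) * (1 - t) * (1 + 2000 * t) = 1 + 1997 * t - 5998 * (t * t) + 4000 * (t * t * t)"
      by (simp add: algebra_simps)
    ultimately have "1 \<le> (1 - 2 * t) * (1 - t) * (1 + 2000 * t)" using t by linarith
    then have "1 / (1 + 2000 * t) \<le> (1 - 2 * t) * (1 - t)" using t by (simp add: divide_le_eq)
    then have "1 / (1 + 2000 * t) / d \<le> (1 - 2 * t) * (1 - t) / d" by (rule divide_right_mono) simp
    also have "\<dots> \<le> measure_pmf.prob (run (natural_alg d) [] es) {h. e \<in> accepted h}"
      using prob_accepted_ge_main[OF E deg 2] 2 by (simp add: t_def natural_alg_def)
    finally show ?thesis by (simp add: prob t_def mult.commute)
  next
    case 3
    \<comment> \<open>The constant \<open>2000\<close> is large enough that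
      \<open>1 + 2000 / 6\<close> exceeds \<open>256\<close>.\<close>
    have "1 / (d * (1 + 2000 * slack d)) \<le> 1 / (256 * d)"
      using 3 by (intro divide_left_mono) auto
    also have "\<dots> \<le> measure_pmf.prob (run (natural_alg d) [] es) {h. e \<in> accepted h}"
      using prob_accepted_ge_crude[OF E deg] 3 by (simp add: natural_alg_def)
    finally show ?thesis by (simp add: prob)
  qed
qed

section \<open>Asymptotic form of the bound\<close>

lemma slack_smallo: "(\<lambda>d. 2000 * slack d) \<in> o(\<lambda>_. 1)"
proof (rule smalloI_tendsto)
  have "(\<lambda>d. 2000 * (2 * real d powr (- 1 / 4) * sqrt (ln (real d))) / 1) \<longlonglongrightarrow> 0"
    by real_asymp
  then show "((\<lambda>d. 2000 * slack d / 1) \<longlongrightarrow> 0) sequentially"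
    by (simp only: slack_def)
qed simp

lemma mult_one_plus_slack:
  "real d + 4000 * real d powr (3/4) * sqrt (ln (real d)) = d * (1 + 2000 * slack d)"
proof (cases "d = 0")
  case False
  have "real d * real d powr (- 1 / 4) = real d powr (3/4)"
    using False by (simp add: powr_mult_base)
  then show ?thesis by (simp add: slack_def algebra_simps)
qed simp

theorem theorem1p3:
  "\<exists>(C::real) (A::online_alg). C > 0 \<and> online_matching_alg A \<and>
     (\<forall>V E es \<Delta>. simple_graph V E \<and> max_degree V E = \<Delta> \<and> arrival_order E es \<longrightarrow>
        (\<forall>e\<in>E. measure_pmf.prob (random_matching A \<Delta> es) {M. e \<in> M}
           \<ge> 1 / (real \<Delta> + C * real \<Delta> powr (3/4) * sqrt (ln (real \<Delta>))))) \<and>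
     (\<exists>\<epsilon>::nat \<Rightarrow> real. \<epsilon> \<in> o(\<lambda>_. 1) \<and>
        (\<forall>\<Delta>\<ge>1. 1 / (real \<Delta> + C * real \<Delta> powr (3/4) * sqrt (ln (real \<Delta>)))
           = 1 / ((1 + \<epsilon> \<Delta>) * real \<Delta>)))"
proof (intro exI[of _ 4000] exI[of _ natural_alg] conjI)
  show "\<exists>\<epsilon>::nat \<Rightarrow> real. \<epsilon> \<in> o(\<lambda>_. 1) \<and>
        (\<forall>\<Delta>\<ge>1. 1 / (real \<Delta> + 4000 * real \<Delta> powr (3/4) * sqrt (ln (real \<Delta>)))
           = 1 / ((1 + \<epsilon> \<Delta>) * real \<Delta>))"
    by (intro exI[of _ "\<lambda>d. 2000 * slack d"] conjI slack_smallo)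
       (simp only: mult_one_plus_slack mult.commute[of "1 + _"], blast)
next
  show "\<forall>V E es \<Delta>. simple_graph V E \<and> max_degree V E = \<Delta> \<and> arrival_order E es \<longrightarrow>
        (\<forall>e\<in>E. measure_pmf.prob (random_matching natural_alg \<Delta> es) {M. e \<in> M}
           \<ge> 1 / (real \<Delta> + 4000 * real \<Delta> powr (3/4) * sqrt (ln (real \<Delta>))))"
    unfolding mult_one_plus_slack using prob_natural_alg_ge by blast
qed (use online_matching_natural_alg in simp_all)

end
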